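(* Let $\boldsymbol{\theta}\subseteq[0,2\pi)$ and let $\boldsymbol{\sigma}:\boldsymbol{\theta}\to[1,+\infty)$ satisfy $\sup_{\theta\in\boldsymbol{\theta}}\boldsymbol{\sigma}(\theta)=+\infty$. Then the homothecy-invariant basis $\mathscr{B}^{\boldsymbol{\sigma}}$ fails to differentiate $L^1(\mathbb{R}^2)$.
   Context: Rectangles in $\mathbb{R}^2$ are open and nondegenerate, with arbitrary orientation. The shape $\sigma(R)$ of a rectangle $R$ is the quotient of its longest side-length by its shortest side-length. $\mathscr{B}^{\boldsymbol{\sigma}}$ denotes the collection of all rectangles $R$ for which there exists $\theta\in\boldsymbol{\theta}$ such that the longest side of $R$ makes an angle $\theta$ with the horizontal line and $\sigma(R)=\boldsymbol{\sigma}(\theta)$ (all positions and all sizes are allowed). A (Buseman-Feller) differentiation basis is a collection $\mathscr{B}$ of open subsets of $\mathbb{R}^2$ such that $\inf\{\operatorname{diam}B: B\in\mathscr{B},\ x\in B\}=0$ for every $x\in\mathbb{R}^2$. It is homothecy-invariant if $x+\lambda B\in\mathscr{B}$ for all $B\in\mathscr{B}$, $x\in\mathbb{R}^2$, $\lambda>0$. For $f\in L^1_{\mathrm{loc}}(\mathbb{R}^2)$, $\mathscr{B}$ differentiates $\int f$ if for a.e. $x\in\mathbb{R}^2$ one has $\frac{1}{|B|}\int_B f\to f(x)$ as $\operatorname{diam}B\to0$ with $x\in B\in\mathscr{B}$. For $X\subseteq L^1_{\mathrm{loc}}(\mathbb{R}^2)$, $\mathscr{B}$ differentiates $X$ if it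 differentiates $\int f$ for every $f\in X$. *)

theory Defs
  imports "HOL-Analysis.Analysis"
begin

text \<open>
  The open rectangle with centre \<open>c\<close> whose sides of length \<open>a\<close> make an angle \<open>\<theta>\<close> with the
  horizontal axis and whose sides of length \<open>b\<close> are perpendicular to these.  It depends on
  \<open>\<theta>\<close> only modulo \<open>\<pi>\<close>, as does the angle between two lines.
\<close>

definition rect :: "real^2 \<Rightarrow> real \<Rightarrow> real \<Rightarrow> real \<Rightarrow> (real^2) set" where
  "rect c \<theta> a b =
     {c + s *\<^sub>R vector [cos \<theta>, sin \<theta>] + t *\<^sub>R vector [- sin \<theta>, cos \<theta>] | s t.
        \<bar>s\<bar> < a / 2 \<and> \<bar>t\<bar> < b / 2}"

text \<open>
  Since \<open>0 < b \<le> a\<close>, the sides of length \<open>a\<close> are the longest ones and the shape of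
  the rectangle is \<open>a / b\<close>.  For a square either pair of sides may serve as the longest one.
\<close>

definition rect_basis :: "real set \<Rightarrow> (real \<Rightarrow> real) \<Rightarrow> (real^2) set set" where
  "rect_basis \<Theta> \<sigma> =
     {rect c \<theta> a b | c \<theta> a b. \<theta> \<in> \<Theta> \<and> 0 < b \<and> b \<le> a \<and> a / b = \<sigma> \<theta>}"

text \<open>
  The library's \<^const>\<open>diameter\<close> is real-valued and therefore meaningless on unbounded sets.
\<close>

definition ediam :: "'a::metric_space set \<Rightarrow> ereal" where
  "ediam B = (if bounded B then ereal (diameter B) else \<infinity>)"

text \<open>
  The infimum is taken in \<^typ>\<open>ereal\<close>, so that it is \<open>\<infinity>\<close>, not \<open>0\<close>, if no member contains \<open>x\<close>.
\<close>

definition differentiation_basis :: "(real^2) set set \<Rightarrow> bool" where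
  "differentiation_basis \<B> \<longleftrightarrow>
     (\<forall>B\<in>\<B>. open B) \<and> (\<forall>x. (INF B\<in>{B\<in>\<B>. x \<in> B}. ediam B) = 0)"

definition homothecy_invariant :: "(real^2) set set \<Rightarrow> bool" where
  "homothecy_invariant \<B> \<longleftrightarrow>
     (\<forall>B\<in>\<B>. \<forall>x l. 0 < l \<longrightarrow> (\<lambda>y. x + l *\<^sub>R y) ` B \<in> \<B>)"

text \<open>The filter expressing ``\<open>diam B\<close> tends to 0 with \<open>x \<in> B \<in> \<B>\<close>''.\<close>

definition shrinking_to :: "(real^2) set set \<Rightarrow> real^2 \<Rightarrow> (real^2) set filter" where
  "shrinking_to \<B> x = inf (filtercomap ediam (nhds 0)) (principal {B\<in>\<B>. x \<in> B})"

definition L1_loc :: "(real^2 \<Rightarrow> real) set" where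
  "L1_loc = {f. \<forall>K. compact K \<longrightarrow> set_integrable lebesgue K f}"

definition L1 :: "(real^2 \<Rightarrow> real) set" where
  "L1 = {f. integrable lebesgue f}"

text \<open>The following two notions are intended for \<open>f \<in> L1_loc\<close> and \<open>X \<subseteq> L1_loc\<close>.\<close>

definition differentiates_integral :: "(real^2) set set \<Rightarrow> (real^2 \<Rightarrow> real) \<Rightarrow> bool" where
  "differentiates_integral \<B> f \<longleftrightarrow>
     (AE x in lebesgue.
        ((\<lambda>B. (1 / measure lebesgue B) * (LINT y:B|lebesgue. f y)) \<longlongrightarrow> f x) (shrinking_to \<B> x))"

definition differentiates :: "(real^2) set set \<Rightarrow> (real^2 \<Rightarrow> real) set \<Rightarrow> bool" where
  "differentiates \<B> X \<longleftrightarrow> (\<forall>f\<in>X. differentiates_integral \<B> f)"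

lemma L1_subset_L1_loc: "L1 \<subseteq> L1_loc"
  unfolding L1_def L1_loc_def set_integrable_def
  by (intro subsetI CollectI allI impI integrable_mult_indicator)
     (auto intro: lmeasurable_compact fmeasurableD)

lemma eventually_shrinking_to:
  "eventually P (shrinking_to \<B> x) \<longleftrightarrow>
     (\<exists>d>0. \<forall>B\<in>\<B>. x \<in> B \<longrightarrow> bounded B \<longrightarrow> diameter B < d \<longrightarrow> P B)"
proof
  assume "eventually P (shrinking_to \<B> x)"
  then obtain Q where Q: "eventually Q (nhds 0)"
      and QP: "\<And>B. Q (ediam B) \<Longrightarrow> B \<in> \<B> \<Longrightarrow> x \<in> B \<Longrightarrow> P B"
    unfolding shrinking_to_def eventually_inf_principal eventually_filtercomap by auto
  obtain S where S: "open S" "(0::ereal) \<in> S" "\<And>y. y \<in> S \<Longrightarrow> Q y"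
    using Q unfolding eventually_nhds by auto
  obtain d where d: "d > 0" "{0 - d<..<0 + d} \<subseteq> S"
    using ereal_open_cont_interval[OF S(1,2)] by auto
  have *: "\<exists>e>0. ereal e \<le> d"
    using d(1) by (cases d) (auto intro: exI[of _ 1])
  then obtain e where e: "e > 0" "ereal e \<le> d" by blast
  have "Q (ediam B)" if "bounded B" "diameter B < e" for B :: "(real^2) set"
  proof -
    have "ereal (diameter B) < ereal e" using that by simp
    also have "\<dots> \<le> d" by (rule e)
    finally have "ereal (diameter B) < d" .
    moreover have "- d < 0" using d(1) by (cases d) auto
    then have "- d < ereal (diameter B)"
      using diameter_ge_0[OF that(1)] by (metis ereal_less_eq(5) order_less_le_trans)
    ultimately have "ediam B \<in> S" using d(2) that by (auto simp: ediam_def)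
    then show ?thesis by (rule S)
  qed
  then show "\<exists>d>0. \<forall>B\<in>\<B>. x \<in> B \<longrightarrow> bounded B \<longrightarrow> diameter B < d \<longrightarrow> P B"
    using e(1) QP by blast
next
  assume "\<exists>d>0. \<forall>B\<in>\<B>. x \<in> B \<longrightarrow> bounded B \<longrightarrow> diameter B < d \<longrightarrow> P B"
  then obtain d where d: "d > 0"
      "\<And>B. B \<in> \<B> \<Longrightarrow> x \<in> B \<Longrightarrow> bounded B \<Longrightarrow> diameter B < d \<Longrightarrow> P B" by blast
  have "eventually (\<lambda>y. y < ereal d) (nhds 0)"
    using d(1) by (intro eventually_nhds_in_open[of "{..<ereal d}", simplified]) auto
  moreover have "\<forall>B. ediam B < ereal d \<longrightarrow> B \<in> {B \<in> \<B>. x \<in> B} \<longrightarrow> P B"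
    using d(2) by (auto simp: ediam_def split: if_splits)
  ultimately show "eventually P (shrinking_to \<B> x)"
    unfolding shrinking_to_def eventually_inf_principal eventually_filtercomap by blast
qed

end

theory Submission
  imports Defs
begin

text \<open>
  The directions play no role. A rectangle of unit area and large shape centred at the origin is so thin that
  most of it avoids any bounded set chosen before; so finitely many such rectangles can have a union
  \<open>K\<close> of area at least \<open>N / 2\<close>, although all of them contain a common small ball. A
  mass of size \<open>H s\<^sup>2\<close> concentrated in the corresponding ball in the centre of \<open>s
  K\<close> has mean at least \<open>H\<close> over one of the rectangles through any given point of \<open>s
  K\<close>. Successively chosen translates of \<open>s K\<close>, each removing a proportion of what remains,
  cover the unit disc up to a small set; about \<open>1 / (N s\<^sup>2)\<close> of them suffice, so the total
  mass is of order \<open>H / N\<close>. Summing such functions with \<open>H \<rightarrow>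
  \<infinity>\<close> and summable masses gives an integrable function whose means over arbitrarily small
  rectangles are unbounded at every point of a set of positive measure.
\<close>

section \<open>Coordinates, inclusions, homothecies and area of rectangles\<close>

text \<open>The two expressions are the inner products of \<open>x - c\<close> with the orthonormal
  frame of angle \<open>\<theta>\<close>. They replace the existential parameters of
  \<open>rect\<close> by two explicit inequalities.\<close>

lemma mem_rect_iff:
  "x \<in> rect c \<theta> a b \<longleftrightarrow>
     \<bar>(x$1 - c$1) * cos \<theta> + (x$2 - c$2) * sin \<theta>\<bar> < a / 2 \<and>
     \<bar>(x$2 - c$2) * cos \<theta> - (x$1 - c$1) * sin \<theta>\<bar> < b / 2"
  (is "_ \<longleftrightarrow> \<bar>?s\<bar> < _ \<and> \<bar>?t\<bar> < _")
proof
  assume "x \<in> rect c \<theta> a b"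
  then obtain s t where x: "x = c + s *\<^sub>R vector [cos \<theta>, sin \<theta>] + t *\<^sub>R vector [- sin \<theta>, cos \<theta>]"
    and st: "\<bar>s\<bar> < a / 2" "\<bar>t\<bar> < b / 2"
    unfolding rect_def by blast
  \<comment> \<open>The factor \<open>cos^2 + sin^2\<close> is left standing, so that these are
    polynomial identities in \<open>cos \<theta>\<close> and \<open>sin \<theta>\<close>; Pythagoras
    enters only afterwards.\<close>
  have "?s = s * ((cos \<theta>)\<^sup>2 + (sin \<theta>)\<^sup>2)" "?t = t * ((cos \<theta>)\<^sup>2 + (sin \<theta>)\<^sup>2)"
    unfolding x by (simp_all add: algebra_simps power2_eq_square del: sin_cos_squared_add sin_cos_squared_add2 sin_cos_squared_add3)
  then show "\<bar>?s\<bar> < a / 2 \<and> \<bar>?t\<bar> < b / 2" using st by simp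
next
  assume st: "\<bar>?s\<bar> < a / 2 \<and> \<bar>?t\<bar> < b / 2"
  have "?s * cos \<theta> - ?t * sin \<theta> = (x$1 - c$1) * ((cos \<theta>)\<^sup>2 + (sin \<theta>)\<^sup>2)"
    "?s * sin \<theta> + ?t * cos \<theta> = (x$2 - c$2) * ((cos \<theta>)\<^sup>2 + (sin \<theta>)\<^sup>2)"
    by (simp_all add: algebra_simps power2_eq_square del: sin_cos_squared_add sin_cos_squared_add2 sin_cos_squared_add3)
  then have "x$1 = c$1 + (?s * cos \<theta> - ?t * sin \<theta>)" "x$2 = c$2 + (?s * sin \<theta> + ?t * cos \<theta>)"
    by simp_all
  then have "x = c + ?s *\<^sub>R vector [cos \<theta>, sin \<theta>] + ?t *\<^sub>R vector [- sin \<theta>, cos \<theta>]"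
    unfolding vec_eq_iff forall_2 by simp
  with st show "x \<in> rect c \<theta> a b" unfolding rect_def by blast
qed

text \<open>Applied to \<open>x - c\<close>, this compares rectangles with balls; applied with angle
  \<open>-\<theta>\<close>, it shows that the parametrisation of a rectangle is an isometry.\<close>

lemma rotated_coords_norm:
  fixes x :: "real^2"
  shows "(x$1 * cos \<theta> + x$2 * sin \<theta>)\<^sup>2 + (x$2 * cos \<theta> - x$1 * sin \<theta>)\<^sup>2 = (norm x)\<^sup>2"
proof -
  have "(x$1 * cos \<theta> + x$2 * sin \<theta>)\<^sup>2 + (x$2 * cos \<theta> - x$1 * sin \<theta>)\<^sup>2
      = ((x$1)\<^sup>2 + (x$2)\<^sup>2) * ((cos \<theta>)\<^sup>2 + (sin \<theta>)\<^sup>2)"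
    by (simp add: algebra_simps power2_eq_square del: sin_cos_squared_add sin_cos_squared_add2 sin_cos_squared_add3)
  also have "\<dots> = (norm x)\<^sup>2"
    by (simp add: norm_vec_def L2_set_def sum_2)
  finally show ?thesis .
qed

lemma open_rect: "open (rect c \<theta> a b)"
proof -
  have "rect c \<theta> a b = {x. \<bar>(x$1 - c$1) * cos \<theta> + (x$2 - c$2) * sin \<theta>\<bar> < a / 2} \<inter>
     {x. \<bar>(x$2 - c$2) * cos \<theta> - (x$1 - c$1) * sin \<theta>\<bar> < b / 2}"
    using mem_rect_iff by blast
  then show ?thesis by (auto intro!: open_Int open_Collect_less continuous_intros)
qed

lemma rect_subset_ball:
  assumes "0 < b" "b \<le> a"
  shows "rect c \<theta> a b \<subseteq> ball c a"
proof
  fix x assume x: "x \<in> rect c \<theta> a b"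
  let ?s = "(x$1 - c$1) * cos \<theta> + (x$2 - c$2) * sin \<theta>"
  let ?t = "(x$2 - c$2) * cos \<theta> - (x$1 - c$1) * sin \<theta>"
  have st: "\<bar>?s\<bar> < a / 2" "\<bar>?t\<bar> < a / 2"
    using x assms(2) by (auto simp: mem_rect_iff)
  have "(norm (x - c))\<^sup>2 = ?s\<^sup>2 + ?t\<^sup>2"
    using rotated_coords_norm[of "x - c" \<theta>] by simp
  also have "\<dots> \<le> (a/2)\<^sup>2 + (a/2)\<^sup>2"
    using st by (intro add_mono power2_le_iff_abs_le[THEN iffD2]) (use assms in auto)
  also have "\<dots> < a\<^sup>2" using assms by (simp add: power2_eq_square)
  finally have "norm (x - c) < a"
    by (rule power_less_imp_less_base) (use assms in auto)
  then show "x \<in> ball c a" by (simp add: dist_norm norm_minus_commute)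
qed

lemma ball_subset_rect:
  assumes "b \<le> a" "r \<le> b / 2"
  shows "ball c r \<subseteq> rect c \<theta> a b"
proof
  fix x assume x: "x \<in> ball c r"
  let ?s = "(x$1 - c$1) * cos \<theta> + (x$2 - c$2) * sin \<theta>"
  let ?t = "(x$2 - c$2) * cos \<theta> - (x$1 - c$1) * sin \<theta>"
  have nr: "norm (x - c) < r" using x by (simp add: dist_norm norm_minus_commute)
  have *: "(norm (x - c))\<^sup>2 = ?s\<^sup>2 + ?t\<^sup>2"
    using rotated_coords_norm[of "x - c" \<theta>] by simp
  have "?s\<^sup>2 \<le> (norm (x - c))\<^sup>2" "?t\<^sup>2 \<le> (norm (x - c))\<^sup>2" unfolding * by simp_all
  then have "\<bar>?s\<bar> \<le> norm (x - c)" "\<bar>?t\<bar> \<le> norm (x - c)" by (simp_all add: power2_le_iff_abs_le)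
  then show "x \<in> rect c \<theta> a b" using nr assms by (simp add: mem_rect_iff)
qed

lemma rect_homothecy:
  assumes "0 < l"
  shows "(\<lambda>y. x + l *\<^sub>R y) ` rect c \<theta> a b = rect (x + l *\<^sub>R c) \<theta> (l * a) (l * b)"
proof -
  have *: "y \<in> rect c \<theta> a b \<longleftrightarrow> x + l *\<^sub>R y \<in> rect (x + l *\<^sub>R c) \<theta> (l * a) (l * b)" for y
  proof -
    have "\<bar>l * u\<bar> < l * a / 2 \<longleftrightarrow> \<bar>u\<bar> < a / 2" for u a
      using assms mult_less_cancel_left_pos[of l "\<bar>u\<bar>" "a / 2"] by (simp add: abs_mult)
    from this[of "(y$1 - c$1) * cos \<theta> + (y$2 - c$2) * sin \<theta>" a]
      this[of "(y$2 - c$2) * cos \<theta> - (y$1 - c$1) * sin \<theta>" b]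
    show ?thesis by (simp add: mem_rect_iff algebra_simps)
  qed
  have "z \<in> (\<lambda>y. x + l *\<^sub>R y) ` rect c \<theta> a b" if "z \<in> rect (x + l *\<^sub>R c) \<theta> (l * a) (l * b)" for z
    using that *[of "(1/l) *\<^sub>R (z - x)"] assms
    by (intro image_eqI[of _ _ "(1/l) *\<^sub>R (z - x)"]) auto
  then show ?thesis using * by blast
qed

text \<open>A centred rectangle is a rotated axis-parallel box, so its area follows from the
  invariance of Lebesgue measure under orthogonal maps.\<close>

lemma rect_zero_eq_rotation_image:
  "rect 0 \<theta> a b =
     (\<lambda>y::real^2. y$1 *\<^sub>R vector [cos \<theta>, sin \<theta>] + y$2 *\<^sub>R vector [- sin \<theta>, cos \<theta>])
       ` box (vector [- a/2, - b/2]) (vector [a/2, b/2])" (is "_ = ?f ` ?B")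
proof
  show "rect 0 \<theta> a b \<subseteq> ?f ` ?B"
  proof
    fix x assume "x \<in> rect 0 \<theta> a b"
    then obtain s t where "x = s *\<^sub>R vector [cos \<theta>, sin \<theta>] + t *\<^sub>R vector [- sin \<theta>, cos \<theta>]"
      "\<bar>s\<bar> < a / 2" "\<bar>t\<bar> < b / 2" unfolding rect_def by auto
    moreover from this have "- (a / 2) < s" "s < a / 2" "- (b / 2) < t" "t < b / 2" by linarith+
    ultimately show "x \<in> ?f ` ?B"
      by (intro image_eqI[of _ _ "vector [s, t]"]) (simp_all add: mem_box_cart forall_2)
  qed
  show "?f ` ?B \<subseteq> rect 0 \<theta> a b"
  proof
    fix x assume "x \<in> ?f ` ?B"
    then obtain y :: "real^2" where "x = ?f y" "y \<in> ?B" by blast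
    then have "x = 0 + y$1 *\<^sub>R vector [cos \<theta>, sin \<theta>] + y$2 *\<^sub>R vector [- sin \<theta>, cos \<theta>]"
      "\<bar>y$1\<bar> < a / 2" "\<bar>y$2\<bar> < b / 2"
      by (auto simp: mem_box_cart forall_2 abs_less_iff)
    then show "x \<in> rect 0 \<theta> a b" unfolding rect_def by blast
  qed
qed

lemma emeasure_rect_zero:
  assumes "0 \<le> a" "0 \<le> b"
  shows "emeasure lborel (rect 0 \<theta> a b) = ennreal (a * b)"
proof -
  let ?f = "\<lambda>y::real^2. y$1 *\<^sub>R vector [cos \<theta>, sin \<theta>] + y$2 *\<^sub>R vector [- sin \<theta>, cos \<theta>] :: real^2"
  let ?B = "box (vector [- a/2, - b/2]) (vector [a/2, b/2]) :: (real^2) set"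
  have lin: "linear ?f"
    by (intro linearI) (simp_all add: vec_eq_iff forall_2 algebra_simps)
  have "norm (?f y) = norm y" for y
  proof -
    \<comment> \<open>The entries of \<open>?f y\<close> are the coordinates of \<open>y\<close> in
      the frame of angle \<open>-\<theta>\<close>.\<close>
    have "(norm (?f y))\<^sup>2 = (norm y)\<^sup>2"
      using rotated_coords_norm[of y "-\<theta>"]
      by (simp add: norm_vec_def L2_set_def sum_2 algebra_simps)
    then show ?thesis by simp
  qed
  then have orth: "orthogonal_transformation ?f"
    using lin by (simp add: orthogonal_transformation)
  have "measure lborel ?B = a * b"
  proof -
    have "measure lborel ?B = measure lborel (cbox (vector [- a/2, - b/2]) (vector [a/2, b/2] :: real^2))"
      by (simp add: measure_lborel_box_eq measure_lborel_cbox_eq)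
    also have "\<dots> = a * b"
      using assms by (subst content_cbox_cart) (simp_all add: interval_ne_empty_cart forall_2 UNIV_2)
    finally show ?thesis .
  qed
  then have "measure lebesgue (rect 0 \<theta> a b) = a * b"
    unfolding rect_zero_eq_rotation_image by (subst measure_orthogonal_image[OF orth]) auto
  moreover have "bounded (rect 0 \<theta> a b)"
    unfolding rect_zero_eq_rotation_image
    by (intro bounded_linear_image bounded_box linear_conv_bounded_linear[THEN iffD1] lin)
  ultimately show ?thesis
    using emeasure_bounded_finite[of "rect 0 \<theta> a b"] open_rect[of 0 \<theta> a b]
    by (simp add: emeasure_eq_ennreal_measure measure_completion borel_open)
qed

lemma emeasure_rect:
  assumes "0 \<le> a" "0 \<le> b"
  shows "emeasure lborel (rect c \<theta> a b) = ennreal (a * b)"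
proof -
  have "rect c \<theta> a b = (\<lambda>y. 1 *\<^sub>R y + c) ` rect 0 \<theta> a b"
    using rect_homothecy[of 1 c 0 \<theta> a b] by (simp add: add.commute)
  then have "emeasure lebesgue (rect c \<theta> a b) = emeasure lebesgue (rect 0 \<theta> a b)"
    using emeasure_lebesgue_affine[of 1 c "rect 0 \<theta> a b"] by simp
  then show ?thesis
    using emeasure_rect_zero[OF assms] by (simp add: emeasure_completion borel_open open_rect)
qed

section \<open>The rectangles form a homothecy-invariant differentiation basis\<close>

lemma differentiation_basis_rect_basis:
  assumes "\<Theta> \<noteq> {}" "\<And>\<theta>. \<theta> \<in> \<Theta> \<Longrightarrow> 1 \<le> \<sigma> \<theta>"
  shows "differentiation_basis (rect_basis \<Theta> \<sigma>)"
  unfolding differentiation_basis_def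
proof (intro conjI ballI allI)
  show "open B" if "B \<in> rect_basis \<Theta> \<sigma>" for B
    using that open_rect unfolding rect_basis_def by auto
  fix x :: "real^2"
  let ?C = "{B \<in> rect_basis \<Theta> \<sigma>. x \<in> B}"
  obtain \<theta> where \<theta>: "\<theta> \<in> \<Theta>" using assms by blast
  have small: "(INF B\<in>?C. ediam B) \<le> ereal e" if "e > 0" for e
  proof -
    \<comment> \<open>The rectangle centred at \<open>x\<close> lies in the ball of radius
      \<open>a\<close>, whose diameter is \<open>e\<close>.\<close>
    define a where "a = e / 2"
    define b where "b = a / \<sigma> \<theta>"
    have s: "1 \<le> \<sigma> \<theta>" using assms \<theta> by auto
    have ab: "0 < b" "b \<le> a" "a / b = \<sigma> \<theta>"
      using that s by (auto simp: a_def b_def field_simps)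
    have "rect x \<theta> a b \<in> ?C"
      using ab \<theta> unfolding rect_basis_def by (auto simp: mem_rect_iff)
    moreover have "ediam (rect x \<theta> a b) \<le> ereal e"
      using diameter_subset[OF rect_subset_ball[OF ab(1,2), of x \<theta>]]
        bounded_subset[OF bounded_ball rect_subset_ball[OF ab(1,2), of x \<theta>]] ab
      by (auto simp: ediam_def a_def split: if_splits)
    ultimately show ?thesis by (rule INF_lower2)
  qed
  have "(INF B\<in>?C. ediam B) \<le> 0"
    by (rule ereal_le_epsilon2) (use small in auto)
  moreover have "0 \<le> (INF B\<in>?C. ediam B)"
    by (rule INF_greatest) (auto simp: ediam_def diameter_ge_0)
  ultimately show "(INF B\<in>?C. ediam B) = 0" by (rule antisym)
qed

lemma homothecy_invariant_rect_basis: "homothecy_invariant (rect_basis \<Theta> \<sigma>)"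
  unfolding homothecy_invariant_def
proof (intro ballI allI impI)
  fix B :: "(real^2) set" and x :: "real^2" and l :: real
  assume "B \<in> rect_basis \<Theta> \<sigma>" and l: "0 < l"
  then obtain c \<theta> a b where B: "B = rect c \<theta> a b" "\<theta> \<in> \<Theta>" "0 < b" "b \<le> a" "a / b = \<sigma> \<theta>"
    unfolding rect_basis_def by blast
  have "(\<lambda>y. x + l *\<^sub>R y) ` B = rect (x + l *\<^sub>R c) \<theta> (l * a) (l * b)"
    unfolding B(1) by (rule rect_homothecy[OF l])
  moreover have "0 < l * b" "l * b \<le> l * a" "(l * a) / (l * b) = \<sigma> \<theta>" using B l by auto
  ultimately show "(\<lambda>y. x + l *\<^sub>R y) ` B \<in> rect_basis \<Theta> \<sigma>"
    using B(2) unfolding rect_basis_def by blast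
qed

section \<open>Covering by translates\<close>

text \<open>
  The integral of \<open>t \<mapsto> |E \<inter> (t + K)|\<close> over \<open>Z\<close> is \<open>|E| |K|\<close> by Tonelli.  The constant 2 spares
  a discussion of the case of equality in the averaging argument.
\<close>

lemma exists_translate:
  fixes E K Z :: "'a::euclidean_space set"
  assumes "E \<in> fmeasurable lborel" "K \<in> fmeasurable lborel" "Z \<in> fmeasurable lborel"
    and Z: "\<And>x y. x \<in> E \<Longrightarrow> y \<in> K \<Longrightarrow> x - y \<in> Z"
  shows "\<exists>t. measure lborel E * measure lborel K \<le>
    2 * measure lborel Z * measure lborel (E \<inter> (+) t ` K)"
proof (rule ccontr)
  assume neg: "\<not> ?thesis"
  have sets [measurable]: "E \<in> sets borel" "K \<in> sets borel" "Z \<in> sets borel"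
    using assms by (auto dest: fmeasurableD)
  let ?p = "measure lborel E * measure lborel K"
  have img: "(+) t ` K = {x. x - t \<in> K}" for t by (force simp: image_iff)
  have fin: "(E \<inter> (+) t ` K) \<in> fmeasurable lborel" for t
    by (rule fmeasurableI2[OF assms(1)]) (unfold img, measurable)
  \<comment> \<open>For fixed \<open>x\<close> the translations \<open>t\<close> with
    \<open>x\<close> in \<open>t + K\<close> form a translate of \<open>-K\<close>, and reflection
    preserves the measure.\<close>
  have refl: "emeasure lborel {t. x - t \<in> K} = emeasure lborel K" for x
  proof -
    have "{t. x - t \<in> K} = (\<lambda>y. (-1) *\<^sub>R y + x) ` K"
      by (force simp: image_iff)
    then have "emeasure lebesgue {t. x - t \<in> K} = emeasure lebesgue K"
      using emeasure_lebesgue_affine[of "-1" x K] by simp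
    then show ?thesis by simp
  qed
  have e: "emeasure lborel E = ennreal (measure lborel E)" "emeasure lborel K = ennreal (measure lborel K)"
    "emeasure lborel Z = ennreal (measure lborel Z)"
    using assms(1-3) by (simp_all add: emeasure_eq_measure2)
  have g: "(\<integral>\<^sup>+x. indicator E x * indicator K (x - t) \<partial>lborel) = ennreal (measure lborel (E \<inter> (+) t ` K))" for t
  proof -
    have "(\<integral>\<^sup>+x. indicator E x * indicator K (x - t) \<partial>lborel) = (\<integral>\<^sup>+x. indicator (E \<inter> (+) t ` K) x \<partial>lborel)"
      unfolding img by (intro nn_integral_cong) (auto split: split_indicator)
    also have "\<dots> = emeasure lborel (E \<inter> (+) t ` K)"
      using fmeasurableD[OF fin[of t]] by (rule nn_integral_indicator)
    finally show ?thesis using fin by (simp add: emeasure_eq_measure2)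
  qed
  have "(\<integral>\<^sup>+t\<in>Z. ennreal (measure lborel (E \<inter> (+) t ` K)) \<partial>lborel)
      = (\<integral>\<^sup>+t. (\<integral>\<^sup>+x. indicator E x * indicator K (x - t) \<partial>lborel) \<partial>lborel)"
  proof (rule nn_integral_cong)
    fix t
    \<comment> \<open>A common point \<open>x\<close> of \<open>E\<close> and \<open>t + K\<close>
      gives \<open>t = x - (x - t)\<close>, a point of \<open>E\<close> minus a point of
      \<open>K\<close>, hence in \<open>Z\<close>. So restricting the integral to \<open>Z\<close>
      loses nothing.\<close>
    have "E \<inter> (+) t ` K = {}" if "t \<notin> Z"
      using Z that unfolding img by (auto, metis add_diff_cancel_right' diff_diff_eq2 add.commute)
    then show "ennreal (measure lborel (E \<inter> (+) t ` K)) * indicator Z t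
       = (\<integral>\<^sup>+x. indicator E x * indicator K (x - t) \<partial>lborel)"
      unfolding g by (auto split: split_indicator)
  qed
  also have "\<dots> = (\<integral>\<^sup>+x. (\<integral>\<^sup>+t. indicator E x * indicator K (x - t) \<partial>lborel) \<partial>lborel)"
    by (rule lborel_pair.Fubini') measurable
  also have "\<dots> = (\<integral>\<^sup>+x. indicator E x * emeasure lborel K \<partial>lborel)"
  proof (rule nn_integral_cong)
    fix x
    have "(\<integral>\<^sup>+t. indicator E x * indicator K (x - t) \<partial>lborel) =
      (\<integral>\<^sup>+t. indicator E x * indicator {t. x - t \<in> K} t \<partial>lborel)"
      by (intro nn_integral_cong) (auto split: split_indicator)
    also have "\<dots> = indicator E x * emeasure lborel K"
      by (subst nn_integral_cmult) (simp_all add: refl)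
    finally show "(\<integral>\<^sup>+t. indicator E x * indicator K (x - t) \<partial>lborel) = indicator E x * emeasure lborel K" .
  qed
  also have "\<dots> = ennreal ?p"
    by (simp add: nn_integral_multc e ennreal_mult)
  finally have total: "(\<integral>\<^sup>+t\<in>Z. ennreal (measure lborel (E \<inter> (+) t ` K)) \<partial>lborel) = ennreal ?p" .
  have pos: "?p > 0" "measure lborel Z > 0"
  proof -
    \<comment> \<open>The negated claim at any single translation, here 0, already forces
      \<open>?p\<close> to be positive; then \<open>Z\<close> cannot be null, since the integral
      over it is \<open>?p\<close>.\<close>
    have *: "2 * measure lborel Z * measure lborel (E \<inter> (+) 0 ` K) < ?p"
      using neg by (meson not_le)
    moreover have "0 \<le> 2 * measure lborel Z * measure lborel (E \<inter> (+) 0 ` K)" by simp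
    ultimately show p: "?p > 0" by linarith
    have "measure lborel Z \<noteq> 0"
    proof
      assume "measure lborel Z = 0"
      then have "AE t in lborel. t \<notin> Z"
        using e(3) by (intro AE_not_in) (simp add: null_sets_def)
      then have "(\<integral>\<^sup>+t\<in>Z. ennreal (measure lborel (E \<inter> (+) t ` K)) \<partial>lborel) = (\<integral>\<^sup>+t. 0 \<partial>(lborel :: 'a measure))"
        by (intro nn_integral_cong_AE) auto
      then show False using total p by auto
    qed
    then show "measure lborel Z > 0" using measure_nonneg[of lborel Z] by linarith
  qed
  let ?z = "measure lborel Z"
  \<comment> \<open>The negated claim bounds the integrand by \<open>?p / (2 * ?z)\<close>, hence
    its integral over \<open>Z\<close> by half of its actual value \<open>?p\<close>.\<close>
  have "ennreal ?p \<le> (\<integral>\<^sup>+t\<in>Z. ennreal (?p / (2 * ?z)) \<partial>lborel)"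
    unfolding total[symmetric]
  proof (intro nn_integral_mono mult_right_mono ennreal_leI)
    fix t
    have "2 * ?z * measure lborel (E \<inter> (+) t ` K) \<le> ?p"
      using neg by (meson less_imp_le not_le)
    then show "measure lborel (E \<inter> (+) t ` K) \<le> ?p / (2 * ?z)"
      using pos by (simp add: field_simps)
  qed simp
  also have "\<dots> = ennreal (?p / (2 * ?z)) * ennreal ?z"
    by (simp add: nn_integral_cmult_indicator e)
  also have "\<dots> = ennreal (?p / 2)"
    using pos by (simp flip: ennreal_mult)
  finally show False using pos by simp
qed

text \<open>Greedy choice: the uncovered part stays inside \<open>Q\<close>, so averaging over the
  same \<open>Z\<close> always yields a translate removing at least the proportion
  \<open>q = |K| / (2 |Z|)\<close> of it. After \<open>m\<close> steps at most
  \<open>(1 - q)^m \<le> exp (- q m)\<close> of \<open>Q\<close> is left, and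
  \<open>m \<ge> L / q\<close> suffices.\<close>

lemma cover_by_translates:
  fixes Q K Z :: "'a::euclidean_space set"
  assumes fm: "Q \<in> fmeasurable lborel" "K \<in> fmeasurable lborel" "Z \<in> fmeasurable lborel"
    and Z: "\<And>x y. x \<in> Q \<Longrightarrow> y \<in> K \<Longrightarrow> x - y \<in> Z"
    and pos: "measure lborel K > 0" "measure lborel Z > 0" and "0 \<le> L"
  obtains t :: "nat \<Rightarrow> 'a" and m :: nat where
    "measure lborel (Q - (\<Union>i<m. (+) (t i) ` K)) \<le> exp (- L) * measure lborel Q"
    "real m \<le> 2 * measure lborel Z * L / measure lborel K + 1"
proof -
  define q where "q = measure lborel K / (2 * measure lborel Z)"
  have q: "q > 0" using pos by (simp add: q_def)
  have sets: "(+) t ` K \<in> sets lborel" for t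
  proof -
    have [measurable]: "K \<in> sets borel" using fm by auto
    have "(+) t ` K = {x. x - t \<in> K}" by (force simp: image_iff)
    then show ?thesis by simp
  qed
  have "\<exists>t :: nat \<Rightarrow> 'a. measure lborel (Q - (\<Union>i<m. (+) (t i) ` K)) \<le> exp (- q) ^ m * measure lborel Q" for m
  proof (induction m)
    case 0
    show ?case by simp
  next
    case (Suc m)
    then obtain t :: "nat \<Rightarrow> 'a"
      where t: "measure lborel (Q - (\<Union>i<m. (+) (t i) ` K)) \<le> exp (- q) ^ m * measure lborel Q" by blast
    define E where "E = Q - (\<Union>i<m. (+) (t i) ` K)"
    have E: "E \<in> fmeasurable lborel"
      unfolding E_def by (intro fmeasurable_Diff fm sets.finite_UN) (use sets in auto)
    obtain u where "measure lborel E * measure lborel K \<le> 2 * measure lborel Z * measure lborel (E \<inter> (+) u ` K)"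
      using exists_translate[OF E fm(2,3)] Z unfolding E_def by blast
    then have u: "q * measure lborel E \<le> measure lborel (E \<inter> (+) u ` K)"
      using pos by (simp add: q_def field_simps)
    let ?t = "t(m := u)"
    have "Q - (\<Union>i<Suc m. (+) (?t i) ` K) = E - (E \<inter> (+) u ` K)"
      unfolding E_def by (auto simp: lessThan_Suc)
    then have "measure lborel (Q - (\<Union>i<Suc m. (+) (?t i) ` K)) = measure lborel E - measure lborel (E \<inter> (+) u ` K)"
      using E sets[of u] fmeasurableD[OF E]
      by (simp only:, intro measure_Diff) (auto simp: fmeasurable_def)
    also have "\<dots> \<le> (1 - q) * measure lborel E" using u by (simp add: algebra_simps)
    also have "\<dots> \<le> exp (- q) * measure lborel E"
      using exp_ge_add_one_self[of "-q"] by (intro mult_right_mono) auto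
    also have "\<dots> \<le> exp (- q) ^ Suc m * measure lborel Q"
      using t unfolding E_def by simp
    finally show ?case by blast
  qed
  then obtain t :: "nat \<Rightarrow> 'a"
    where t: "measure lborel (Q - (\<Union>i<nat \<lceil>L / q\<rceil>. (+) (t i) ` K)) \<le> exp (- q) ^ nat \<lceil>L / q\<rceil> * measure lborel Q" by blast
  \<comment> \<open>Rounding \<open>L / q\<close> up to an integer costs the \<open>+ 1\<close> in
    the bound on \<open>m\<close>.\<close>
  have m: "L / q \<le> real (nat \<lceil>L / q\<rceil>)" "real (nat \<lceil>L / q\<rceil>) \<le> L / q + 1"
    using \<open>0 \<le> L\<close> q by (auto intro: of_nat_ceiling)
  have "exp (- q) ^ nat \<lceil>L / q\<rceil> = exp (- (real (nat \<lceil>L / q\<rceil>) * q))"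
    by (simp flip: exp_of_nat_mult)
  also have "\<dots> \<le> exp (- L)" using m(1) q by (simp add: field_simps)
  finally have "measure lborel (Q - (\<Union>i<nat \<lceil>L / q\<rceil>. (+) (t i) ` K)) \<le> exp (- L) * measure lborel Q"
    by (intro order_trans[OF t] mult_right_mono) auto
  then show ?thesis
    by (rule that) (use m(2) in \<open>simp add: q_def field_simps\<close>)
qed

section \<open>Rectangles normalised by area, and stars of large area\<close>

lemma open_bounded_fmeasurable:
  fixes S :: "'a::euclidean_space set"
  assumes "open S" "bounded S"
  shows "S \<in> fmeasurable lborel"
  using assms emeasure_bounded_finite[of S] by (intro fmeasurableI) auto

text \<open>The parameters are the square root \<open>s\<close> of the area and the shape
  \<open>q\<close>, for \<open>0 < s\<close> and \<open>1 \<le> q\<close>. The area is then the same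
  for all shapes, and a homothecy only rescales \<open>s\<close>.\<close>

definition shaped_rect :: "real^2 \<Rightarrow> real \<Rightarrow> real \<Rightarrow> real \<Rightarrow> (real^2) set" where
  "shaped_rect c s \<theta> q = rect c \<theta> (s * sqrt q) (s / sqrt q)"

lemma shaped_rect_sides:
  assumes "0 < s" "1 \<le> q"
  shows "0 < s / sqrt q" "s / sqrt q \<le> s * sqrt q" "(s * sqrt q) / (s / sqrt q) = q"
    "(s * sqrt q) * (s / sqrt q) = s\<^sup>2"
proof -
  have "sqrt q * sqrt q = q" "1 \<le> sqrt q" using assms by simp_all
  moreover have "s \<le> s * q" using assms by simp
  ultimately show "0 < s / sqrt q" "s / sqrt q \<le> s * sqrt q" "(s * sqrt q) / (s / sqrt q) = q"
    "(s * sqrt q) * (s / sqrt q) = s\<^sup>2"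
    using assms by (auto simp: field_simps power2_eq_square)
qed

lemma shaped_rect_in_basis:
  assumes "0 < s" "\<theta> \<in> \<Theta>" "1 \<le> \<sigma> \<theta>"
  shows "shaped_rect c s \<theta> (\<sigma> \<theta>) \<in> rect_basis \<Theta> \<sigma>"
  unfolding rect_basis_def shaped_rect_def using shaped_rect_sides[OF assms(1,3)] assms(2) by blast

lemma shaped_rect_subset_ball:
  assumes "0 < s" "1 \<le> q"
  shows "shaped_rect c s \<theta> q \<subseteq> ball c (s * sqrt q)"
  unfolding shaped_rect_def using shaped_rect_sides[OF assms] by (intro rect_subset_ball) auto

lemma shaped_rect_fmeasurable:
  assumes "0 < s" "1 \<le> q"
  shows "shaped_rect c s \<theta> q \<in> fmeasurable lborel"
  using bounded_subset[OF bounded_ball shaped_rect_subset_ball[OF assms]]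
  by (intro open_bounded_fmeasurable) (simp_all add: shaped_rect_def open_rect)

lemma emeasure_shaped_rect:
  assumes "0 < s" "1 \<le> q"
  shows "emeasure lborel (shaped_rect c s \<theta> q) = ennreal (s\<^sup>2)"
  unfolding shaped_rect_def using shaped_rect_sides[OF assms] by (subst emeasure_rect) auto

lemma shaped_rect_homothecy:
  assumes "0 < l"
  shows "(\<lambda>y. x + l *\<^sub>R y) ` shaped_rect c s \<theta> q = shaped_rect (x + l *\<^sub>R c) (l * s) \<theta> q"
  unfolding shaped_rect_def rect_homothecy[OF assms] by (simp add: mult.assoc)

text \<open>A rectangle of unit area and sufficiently large shape is so thin that at least half of it
  lies outside any given bounded set, whatever its direction.\<close>

lemma exists_star:
  assumes unb: "\<And>C. \<exists>\<theta>\<in>\<Theta>. C < \<sigma> \<theta>" and ge1: "\<And>\<theta>. \<theta> \<in> \<Theta> \<Longrightarrow> 1 \<le> \<sigma> \<theta>"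
  shows "\<exists>J. finite J \<and> J \<subseteq> \<Theta> \<and>
    real N / 2 \<le> measure lborel (\<Union>\<theta>\<in>J. shaped_rect 0 1 \<theta> (\<sigma> \<theta>))"
proof (induction N)
  case 0
  show ?case by (rule exI[of _ "{}"]) simp
next
  case (Suc N)
  then obtain J where J: "finite J" "J \<subseteq> \<Theta>"
    "real N / 2 \<le> measure lborel (\<Union>\<theta>\<in>J. shaped_rect 0 1 \<theta> (\<sigma> \<theta>))" by blast
  define K where "K = (\<Union>\<theta>\<in>J. shaped_rect 0 1 \<theta> (\<sigma> \<theta>))"
  have K: "K \<in> fmeasurable lborel"
    unfolding K_def using J ge1 by (intro fmeasurable.finite_UN shaped_rect_fmeasurable) auto
  have "bounded K"
    unfolding K_def using J ge1 bounded_subset[OF bounded_ball shaped_rect_subset_ball[OF zero_less_one]]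
    by (intro bounded_UN) blast+
  then obtain r where r: "r > 0" "K \<subseteq> ball 0 r"
    using bounded_subset_ballD by blast
  \<comment> \<open>The bound \<open>(4 * r)^2\<close> makes the shortest side of the new rectangle
    less than \<open>1 / (4 * r)\<close>, so a piece of it of length \<open>2 * r\<close> has area
    at most 1/2.\<close>
  obtain \<theta> where \<theta>: "\<theta> \<in> \<Theta>" "(4 * r)\<^sup>2 < \<sigma> \<theta>" using unb by blast
  define R where "R = shaped_rect 0 1 \<theta> (\<sigma> \<theta>)"
  have R: "R \<in> fmeasurable lborel" unfolding R_def using \<theta> ge1 by (intro shaped_rect_fmeasurable) auto
  have mR: "measure lborel R = 1"
    unfolding R_def measure_def using \<theta> ge1 by (subst emeasure_shaped_rect) auto
  have sq: "4 * r < sqrt (\<sigma> \<theta>)" using \<theta>(2) by (rule real_less_rsqrt)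
  \<comment> \<open>\<open>?T\<close> has the direction and width of \<open>R\<close>, but length
    \<open>2 * r\<close>: in the ball of radius \<open>r\<close> the coordinate along the long axis
    is below \<open>r\<close> in absolute value.\<close>
  let ?T = "rect 0 \<theta> (2 * r) (1 / sqrt (\<sigma> \<theta>))"
  have mT: "emeasure lborel ?T = ennreal (2 * r * (1 / sqrt (\<sigma> \<theta>)))"
    using r ge1[OF \<theta>(1)] by (intro emeasure_rect) auto
  have "R \<inter> K \<subseteq> ?T"
  proof
    fix x assume x: "x \<in> R \<inter> K"
    then have "norm x < r" using r by auto
    moreover have "\<bar>x$1 * cos \<theta> + x$2 * sin \<theta>\<bar> \<le> norm x"
      by (intro power2_le_iff_abs_le[THEN iffD1]) (simp_all flip: rotated_coords_norm[of x \<theta>])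
    ultimately show "x \<in> ?T" using x unfolding R_def shaped_rect_def by (simp add: mem_rect_iff)
  qed
  moreover have "?T \<in> fmeasurable lborel" using mT by (intro fmeasurableI) (simp_all add: open_rect borel_open)
  ultimately have "measure lborel (R \<inter> K) \<le> measure lborel ?T"
    using R K by (intro measure_mono_fmeasurable) auto
  also have "\<dots> \<le> 1 / 2"
  proof -
    have "0 < sqrt (\<sigma> \<theta>)" using r sq by linarith
    then show ?thesis
      unfolding measure_def mT using r sq by (subst enn2real_ennreal) (simp_all add: field_simps)
  qed
  finally have RK: "measure lborel (R \<inter> K) \<le> 1 / 2" .
  have "R = (R \<inter> K) \<union> (R - K)" by blast
  then have "measure lborel R \<le> measure lborel (R \<inter> K) + measure lborel (R - K)"
    using measure_Un_le[of "R \<inter> K" lborel "R - K"] R K by (metis fmeasurableD sets.Diff sets.Int)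
  with RK mR have "1 / 2 \<le> measure lborel (R - K)" by linarith
  moreover have "measure lborel (K \<union> R) = measure lborel K + measure lborel (R - K)"
    by (rule measure_Un2[OF K R])
  ultimately have "real (Suc N) / 2 \<le> measure lborel (K \<union> R)" using J(3) unfolding K_def by simp
  moreover have "K \<union> R = (\<Union>\<theta>\<in>insert \<theta> J. shaped_rect 0 1 \<theta> (\<sigma> \<theta>))" unfolding K_def R_def by blast
  ultimately show ?case
    using J \<theta> by (intro exI[of _ "insert \<theta> J"]) auto
qed

section \<open>Functions of small mass with large means\<close>

text \<open>One building block of the counterexample: \<open>\<epsilon>\<close> controls the mass,
  the exceptional area and the diameters at once, while \<open>H\<close> is arbitrary. With values
  in \<open>ennreal\<close> and the mean written as a product, blocks can be summed and compared
  without integrability conditions.\<close>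

lemma concentrated_masses:
  assumes unb: "\<And>C. \<exists>\<theta>\<in>\<Theta>. C < \<sigma> \<theta>" and ge1: "\<And>\<theta>. \<theta> \<in> \<Theta> \<Longrightarrow> 1 \<le> \<sigma> \<theta>"
    and H: "0 < H" and \<epsilon>: "0 < \<epsilon>"
  shows "\<exists>g W. g \<in> borel_measurable borel \<and> W \<in> sets borel \<and>
    (\<integral>\<^sup>+x. g x \<partial>lborel) \<le> ennreal \<epsilon> \<and> measure lborel (ball 0 1 - W) \<le> \<epsilon> \<and>
    (\<forall>x\<in>W. \<exists>B\<in>rect_basis \<Theta> \<sigma>. x \<in> B \<and> bounded B \<and> diameter B < \<epsilon> \<and>
       0 < emeasure lborel B \<and> ennreal H * emeasure lborel B \<le> (\<integral>\<^sup>+y\<in>B. g y \<partial>lborel))"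
proof -
  define z where "z = measure lborel (ball (0::real^2) 2)"
  define w where "w = measure lborel (ball (0::real^2) 1)"
  have z: "z > 0" and w: "w > 0" unfolding z_def w_def by (auto simp: content_ball_pos)
  \<comment> \<open>This makes the uncovered area \<open>exp (- L) * w\<close> at most
    \<open>\<epsilon>\<close>; the maximum with 0 meets the condition \<open>0 \<le> L\<close> of
    the covering lemma.\<close>
  define L where "L = max 0 (ln (w / \<epsilon>))"
  have L: "0 \<le> L" by (simp add: L_def)
  have Lw: "exp (- L) * w \<le> \<epsilon>"
  proof -
    have "exp (- L) * w \<le> exp (- ln (w / \<epsilon>)) * w"
      using w by (intro mult_right_mono) (auto simp: L_def)
    also have "\<dots> = \<epsilon>" using w \<epsilon> by (simp add: exp_minus)
    finally show ?thesis .
  qed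
  \<comment> \<open>The total mass will be at most \<open>4 * z * L * H / N + s^2 * H\<close>. This
    \<open>N\<close> makes the first term at most \<open>\<epsilon> / 2\<close>, and
    \<open>+ 1\<close> keeps \<open>N\<close> positive when \<open>L = 0\<close>.\<close>
  obtain N :: nat where N: "8 * z * L * H / \<epsilon> + 1 \<le> real N" using real_arch_simple by blast
  have "0 \<le> 8 * z * L * H / \<epsilon>" using z L H \<epsilon> by simp
  with N have N0: "0 < real N" by linarith
  obtain J where J: "finite J" "J \<subseteq> \<Theta>"
      "real N / 2 \<le> measure lborel (\<Union>\<theta>\<in>J. shaped_rect 0 1 \<theta> (\<sigma> \<theta>))"
    using exists_star[OF unb ge1] by blast
  have J1: "1 \<le> \<sigma> \<theta>" if "\<theta> \<in> J" for \<theta> using ge1 J that by blast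
  \<comment> \<open>A positive common bound for the \<open>sqrt (\<sigma> \<theta>)\<close>; the sum
    stands in for a maximum.\<close>
  define D where "D = (\<Sum>\<theta>\<in>J. sqrt (\<sigma> \<theta>)) + 1"
  have D: "D > 0"
    unfolding D_def by (intro add_nonneg_pos sum_nonneg) (use J1 in \<open>force+\<close>)
  have sqD: "sqrt (\<sigma> \<theta>) \<le> D" if "\<theta> \<in> J" for \<theta>
  proof -
    have "sqrt (\<sigma> \<theta>) \<le> (\<Sum>\<theta>\<in>J. sqrt (\<sigma> \<theta>))"
      by (rule member_le_sum[OF that]) (use J J1 in \<open>force+\<close>)
    then show ?thesis by (simp add: D_def)
  qed
  \<comment> \<open>In order, the bounds give \<open>s^2 \<le> s\<close>, a star inside the unit
    disc, diameters below \<open>\<epsilon>\<close>, and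
    \<open>s^2 * H \<le> \<epsilon> / 2\<close>, the mass due to rounding up the number of
    translates.\<close>
  define s where "s = min 1 (min (1 / D) (min (\<epsilon> / (4 * D)) (\<epsilon> / (2 * H))))"
  have s: "0 < s" "s \<le> 1" "s \<le> 1 / D" "s \<le> \<epsilon> / (4 * D)" "s \<le> \<epsilon> / (2 * H)"
    unfolding s_def using D \<epsilon> H by auto
  have sD: "s * D \<le> 1" "2 * (s * D) < \<epsilon>"
  proof -
    show "s * D \<le> 1" using s D by (simp add: field_simps)
    have "4 * (s * D) \<le> \<epsilon>" using s D by (simp add: field_simps)
    then show "2 * (s * D) < \<epsilon>" using \<epsilon> by linarith
  qed
  have "s\<^sup>2 * H \<le> s * H" using s H by (simp add: power2_eq_square)
  also have "\<dots> \<le> \<epsilon> / 2" using s H by (simp add: field_simps)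
  finally have sH: "s\<^sup>2 * H \<le> \<epsilon> / 2" .
  define K where "K = (\<Union>\<theta>\<in>J. shaped_rect 0 s \<theta> (\<sigma> \<theta>))"
  have K: "K \<in> fmeasurable lborel"
    unfolding K_def using J J1 s by (intro fmeasurable.finite_UN shaped_rect_fmeasurable) auto
  have Kball: "K \<subseteq> ball 0 1"
  proof -
    have "shaped_rect 0 s \<theta> (\<sigma> \<theta>) \<subseteq> ball 0 1" if "\<theta> \<in> J" for \<theta>
    proof -
      have "s * sqrt (\<sigma> \<theta>) \<le> 1" using mult_left_mono[OF sqD[OF that], of s] s sD by linarith
      then show ?thesis using shaped_rect_subset_ball[OF s(1) J1[OF that]] by fastforce
    qed
    then show ?thesis unfolding K_def by blast
  qed
  have mK: "s\<^sup>2 * (real N / 2) \<le> measure lborel K"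
  proof -
    let ?S = "\<Union>\<theta>\<in>J. shaped_rect 0 1 \<theta> (\<sigma> \<theta>)"
    have "K = (\<lambda>y. s *\<^sub>R y + 0) ` ?S"
      unfolding K_def using shaped_rect_homothecy[OF s(1), of 0 0 1] by (simp add: image_UN)
    then have "measure lebesgue K = s\<^sup>2 * measure lebesgue ?S"
      using measure_lebesgue_affine[of s 0 ?S] by simp
    moreover have "measure lebesgue ?S = measure lborel ?S"
      using J J1 by (intro measure_completion sets.finite_UN fmeasurableD shaped_rect_fmeasurable) simp_all
    moreover have "measure lebesgue K = measure lborel K"
      using K by (intro measure_completion) auto
    ultimately have "measure lborel K = s\<^sup>2 * measure lborel ?S" by simp
    then show ?thesis using mult_left_mono[OF J(3) zero_le_power2[of s]] by (simp only:)
  qed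
  have "0 < s\<^sup>2 * (real N / 2)" using s N0 by simp
  with mK have mK0: "0 < measure lborel K" by linarith
  \<comment> \<open>The disc of radius 2 serves as the set \<open>Z\<close> of candidate
    translations.\<close>
  have diff: "x - y \<in> ball 0 2" if "x \<in> ball 0 1" "y \<in> K" for x y
    using that Kball norm_triangle_ineq4[of x y] by fastforce
  obtain t :: "nat \<Rightarrow> real^2" and m where
    t: "measure lborel (ball 0 1 - (\<Union>i<m. (+) (t i) ` K)) \<le> exp (- L) * w" and
    m: "real m \<le> 2 * z * L / measure lborel K + 1"
    using cover_by_translates[OF open_bounded_fmeasurable K open_bounded_fmeasurable diff mK0 _ L] z
    unfolding z_def w_def by (metis open_ball bounded_ball)
  \<comment> \<open>Every shortest side is at least \<open>s / D\<close>, so the ball of radius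
    \<open>r\<close> about the centre of a star lies in all its rectangles.\<close>
  define r where "r = s / (2 * D)"
  have r: "r > 0" using s D by (simp add: r_def)
  define v where "v = measure lborel (ball (0::real^2) r)"
  have v: "v > 0" unfolding v_def using r by (simp add: content_ball_pos)
  have ev: "emeasure lborel (ball c r) = ennreal v" for c :: "real^2"
    using r unfolding v_def by (simp add: emeasure_ball content_ball)
  \<comment> \<open>Each ball, of area \<open>v\<close>, receives mass \<open>H * s^2\<close>, which
    is \<open>H\<close> times the area of each rectangle of its star. Overlapping balls only
    increase the means.\<close>
  define g where "g = (\<lambda>x. \<Sum>i<m. ennreal (H * s\<^sup>2 / v) * indicator (ball (t i) r) x)"
  have mass: "(\<integral>\<^sup>+x. ennreal (H * s\<^sup>2 / v) * indicator (ball c r) x \<partial>lborel) = ennreal (H * s\<^sup>2)" for c :: "real^2"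
    using v H s by (simp add: nn_integral_cmult_indicator ev flip: ennreal_mult)
  have bump: "(\<lambda>x. ennreal (H * s\<^sup>2 / v) * indicator (ball c r) x) \<in> borel_measurable borel" for c :: "real^2"
    by (intro borel_measurable_times_ennreal borel_measurable_const borel_measurable_indicator) simp
  have "(\<integral>\<^sup>+x. g x \<partial>lborel) = (\<Sum>i<m. ennreal (H * s\<^sup>2))"
    unfolding g_def by (subst nn_integral_sum) (simp_all add: mass bump)
  also have "\<dots> = ennreal (real m * (H * s\<^sup>2))"
    using H by (simp add: ennreal_mult' ennreal_of_nat_eq_real_of_nat)
  also have "\<dots> \<le> ennreal \<epsilon>"
  proof (rule ennreal_leI)
    have "real m \<le> 2 * z * L / (s\<^sup>2 * (real N / 2)) + 1"
      using mK mK0 z L s N0 by (intro order_trans[OF m] add_mono divide_left_mono mult_pos_pos) auto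
    then have "real m * (H * s\<^sup>2) \<le> (2 * z * L / (s\<^sup>2 * (real N / 2)) + 1) * (H * s\<^sup>2)"
      using H by (intro mult_right_mono) auto
    also have "\<dots> = 4 * z * L * H / real N + s\<^sup>2 * H"
      using s N0 by (simp add: field_simps)
    also have "4 * z * L * H / real N \<le> \<epsilon> / 2"
    proof -
      have "8 * z * L * H / \<epsilon> \<le> real N" using N by linarith
      then show ?thesis using \<epsilon> N0 by (simp add: field_simps)
    qed
    finally show "real m * (H * s\<^sup>2) \<le> \<epsilon>" using sH by linarith
  qed
  finally have gint: "(\<integral>\<^sup>+x. g x \<partial>lborel) \<le> ennreal \<epsilon>" .
  have meas: "g \<in> borel_measurable borel" unfolding g_def by (intro borel_measurable_sum bump)
  define W where "W = (\<Union>i<m. (+) (t i) ` K)"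
  have imgK: "(+) c ` K = (\<Union>\<theta>\<in>J. shaped_rect c s \<theta> (\<sigma> \<theta>))" for c
    unfolding K_def using shaped_rect_homothecy[of 1 c 0 s] by (simp add: image_UN)
  have "W \<in> sets borel"
    unfolding W_def imgK shaped_rect_def by (intro borel_open open_UN ballI open_rect)
  moreover have "\<exists>B\<in>rect_basis \<Theta> \<sigma>. x \<in> B \<and> bounded B \<and> diameter B < \<epsilon> \<and>
       0 < emeasure lborel B \<and> ennreal H * emeasure lborel B \<le> (\<integral>\<^sup>+y\<in>B. g y \<partial>lborel)" if xW: "x \<in> W" for x
  proof -
    obtain i \<theta> where i: "i < m" and \<theta>: "\<theta> \<in> J" and x: "x \<in> shaped_rect (t i) s \<theta> (\<sigma> \<theta>)"
      using xW unfolding W_def imgK by blast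
    let ?B = "shaped_rect (t i) s \<theta> (\<sigma> \<theta>)"
    note sub = shaped_rect_subset_ball[OF s(1) J1[OF \<theta>], of "t i" \<theta>]
    have "bounded ?B" using bounded_subset[OF bounded_ball sub] .
    moreover have "diameter ?B < \<epsilon>"
    proof -
      have "0 \<le> s * sqrt (\<sigma> \<theta>)" using s J1[OF \<theta>] by simp
      then have "diameter ?B \<le> 2 * (s * sqrt (\<sigma> \<theta>))"
        using diameter_subset[OF sub bounded_ball] by (simp split: if_splits)
      also have "\<dots> \<le> 2 * (s * D)" using sqD[OF \<theta>] s by (simp add: mult_left_mono)
      finally show ?thesis using sD by linarith
    qed
    moreover have "?B \<in> rect_basis \<Theta> \<sigma>"
      using \<theta> J J1 s by (intro shaped_rect_in_basis) auto
    moreover have eB: "emeasure lborel ?B = ennreal (s\<^sup>2)"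
      using J1[OF \<theta>] s by (intro emeasure_shaped_rect) auto
    moreover have "ball (t i) r \<subseteq> ?B"
      unfolding shaped_rect_def
    proof (rule ball_subset_rect)
      show "s / sqrt (\<sigma> \<theta>) \<le> s * sqrt (\<sigma> \<theta>)" using shaped_rect_sides[OF s(1) J1[OF \<theta>]] by simp
      have "0 < sqrt (\<sigma> \<theta>)" using J1[OF \<theta>] by simp
      then have "s / D \<le> s / sqrt (\<sigma> \<theta>)" using sqD[OF \<theta>] s D by (intro divide_left_mono) auto
      then show "r \<le> s / sqrt (\<sigma> \<theta>) / 2" unfolding r_def by simp
    qed
    then have "(\<integral>\<^sup>+y. ennreal (H * s\<^sup>2 / v) * indicator (ball (t i) r) y \<partial>lborel) \<le> (\<integral>\<^sup>+y\<in>?B. g y \<partial>lborel)"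
    proof (intro nn_integral_mono)
      fix y assume sb: "ball (t i) r \<subseteq> ?B"
      have "ennreal (H * s\<^sup>2 / v) * indicator (ball (t i) r) y \<le> g y"
        unfolding g_def by (rule member_le_sum) (use i in auto)
      then show "ennreal (H * s\<^sup>2 / v) * indicator (ball (t i) r) y \<le> g y * indicator ?B y"
        using sb by (auto split: split_indicator)
    qed
    then have "ennreal H * emeasure lborel ?B \<le> (\<integral>\<^sup>+y\<in>?B. g y \<partial>lborel)"
      unfolding mass eB using H by (simp add: ennreal_mult)
    moreover have "0 < emeasure lborel ?B" unfolding eB using s by simp
    ultimately show ?thesis using x by blast
  qed
  moreover have "measure lborel (ball 0 1 - W) \<le> \<epsilon>" using t Lw unfolding W_def by (rule order_trans)
  ultimately show ?thesis using meas gint by (intro exI[of _ g] exI[of _ W] conjI ballI)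
qed

section \<open>An integrable function with unbounded means\<close>

text \<open>The blocks with \<open>H = k + 1\<close> and \<open>\<epsilon> = e k\<close> are summed.
  Their exceptional areas add up to less than the area of the disc, so a non-null set of points
  belongs to every \<open>W k\<close>; there the means over ever smaller rectangles exceed every
  bound.\<close>

lemma not_differentiates_rect_basis:
  assumes unb: "\<And>C. \<exists>\<theta>\<in>\<Theta>. C < \<sigma> \<theta>" and ge1: "\<And>\<theta>. \<theta> \<in> \<Theta> \<Longrightarrow> 1 \<le> \<sigma> \<theta>"
  shows "\<not> differentiates (rect_basis \<Theta> \<sigma>) L1"
proof
  assume diff: "differentiates (rect_basis \<Theta> \<sigma>) L1"
  let ?Q = "ball (0::real^2) 1"
  define w where "w = measure lborel ?Q"
  have w: "w > 0" unfolding w_def by (simp add: content_ball_pos)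
  \<comment> \<open>A geometric series of sum \<open>min 1 w / 4\<close>: finite for the total mass,
    below \<open>w\<close> for the exceptional areas, with terms tending to 0 for the
    diameters.\<close>
  define e where "e k = min 1 w / 2 * (1 / 2) ^ Suc (Suc k)" for k :: nat
  have e: "e k > 0" for k using w by (simp add: e_def)
  have esum: "(\<lambda>k. e k) sums (min 1 w / 4)"
    unfolding e_def using sums_mult[OF sums_mult[OF power_half_series, of "1/2"], of "min 1 w / 2"]
    by (simp add: mult.assoc)
  let ?P = "\<lambda>k g W. g \<in> borel_measurable borel \<and> W \<in> sets borel \<and>
    (\<integral>\<^sup>+x. g x \<partial>lborel) \<le> ennreal (e k) \<and> measure lborel (?Q - W) \<le> e k \<and>
    (\<forall>x\<in>W. \<exists>B\<in>rect_basis \<Theta> \<sigma>. x \<in> B \<and> bounded B \<and> diameter B < e k \<and>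
       0 < emeasure lborel B \<and> ennreal (real (Suc k)) * emeasure lborel B \<le> (\<integral>\<^sup>+y\<in>B. g y \<partial>lborel))"
  have "\<forall>k. \<exists>g W. ?P k g W"
    by (intro allI concentrated_masses[OF unb ge1 _ e]) simp_all
  then have "\<exists>g W. \<forall>k. ?P k (g k) (W k)" by (simp only: choice_iff)
  then obtain g W where gW: "\<forall>k. ?P k (g k) (W k)" by (elim exE) (rule that)
  from gW have g [measurable]: "\<And>k. g k \<in> borel_measurable borel"
    and W [measurable]: "\<And>k. W k \<in> sets borel"
    and gint: "\<And>k. (\<integral>\<^sup>+x. g k x \<partial>lborel) \<le> ennreal (e k)"
    and mW: "\<And>k. measure lborel (?Q - W k) \<le> e k"
    and large: "\<And>k. \<forall>x\<in>W k. \<exists>B\<in>rect_basis \<Theta> \<sigma>. x \<in> B \<and> bounded B \<and> diameter B < e k \<and>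
       0 < emeasure lborel B \<and> ennreal (real (Suc k)) * emeasure lborel B \<le> (\<integral>\<^sup>+y\<in>B. g k y \<partial>lborel)"
    by simp_all
  define F where "F x = (\<Sum>k. g k x)" for x
  have F [measurable]: "F \<in> borel_measurable borel" unfolding F_def by measurable
  have esuminf: "(\<Sum>k. ennreal (e k)) = ennreal (min 1 w / 4)"
    using esum e by (intro suminf_ennreal_eq) (auto intro: less_imp_le)
  have "(\<integral>\<^sup>+x. F x \<partial>lborel) = (\<Sum>k. \<integral>\<^sup>+x. g k x \<partial>lborel)"
    unfolding F_def by (rule nn_integral_suminf) simp
  also have "\<dots> \<le> (\<Sum>k. ennreal (e k))" by (intro suminf_le gint) auto
  finally have Fint: "(\<integral>\<^sup>+x. F x \<partial>lborel) < \<infinity>" unfolding esuminf by (simp add: le_less_trans)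
  then have Ffin: "AE x in lborel. F x \<noteq> \<infinity>" by (intro nn_integral_PInf_AE) auto
  \<comment> \<open>\<open>enn2real\<close> sends the value \<open>\<infinity>\<close> to 0;
    \<open>F\<close> takes it only on a null set, so integrals agree.\<close>
  define f where "f x = enn2real (F x)" for x
  have f [measurable]: "f \<in> borel_measurable borel" unfolding f_def by measurable
  have fF: "AE x in lborel. ennreal (f x) = F x"
    using Ffin unfolding f_def by eventually_elim (simp add: top.not_eq_extremum)
  have fint: "integrable lborel f"
  proof (rule integrableI_nonneg)
    have "(\<integral>\<^sup>+x. ennreal (f x) \<partial>lborel) = (\<integral>\<^sup>+x. F x \<partial>lborel)" by (rule nn_integral_cong_AE[OF fF])
    then show "(\<integral>\<^sup>+x. ennreal (f x) \<partial>lborel) < \<infinity>" using Fint by simp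
  qed (auto simp: f_def)
  then have "f \<in> L1" unfolding L1_def by (simp add: integrable_completion)
  with diff have ae: "AE x in lborel.
        ((\<lambda>B. (1 / measure lebesgue B) * (LINT y:B|lebesgue. f y)) \<longlongrightarrow> f x) (shrinking_to (rect_basis \<Theta> \<sigma>) x)"
    unfolding differentiates_def differentiates_integral_def by (simp add: AE_completion_iff)
  define G where "G = ?Q \<inter> (\<Inter>k. W k)"
  have "emeasure lborel (\<Union>k. ?Q - W k) \<le> (\<Sum>k. emeasure lborel (?Q - W k))"
    by (rule emeasure_subadditive_countably) auto
  also have "\<dots> \<le> (\<Sum>k. ennreal (e k))"
  proof (intro suminf_le)
    fix k
    have "emeasure lborel (?Q - W k) \<le> emeasure lborel ?Q" by (intro emeasure_mono) auto
    also have "\<dots> < \<infinity>" by (rule emeasure_lborel_ball_finite)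
    finally have "emeasure lborel (?Q - W k) \<noteq> top" by simp
    then show "emeasure lborel (?Q - W k) \<le> ennreal (e k)"
      using mW[of k] by (simp add: emeasure_eq_ennreal_measure ennreal_leI)
  qed auto
  finally have bad: "emeasure lborel (\<Union>k. ?Q - W k) \<le> ennreal (min 1 w / 4)" unfolding esuminf .
  have "\<not> (AE x in lborel. x \<notin> G)"
  proof
    assume "AE x in lborel. x \<notin> G"
    \<comment> \<open>A point of the disc outside \<open>G\<close> is missed by some
      \<open>W k\<close>.\<close>
    then have "emeasure lborel ?Q \<le> emeasure lborel (\<Union>k. ?Q - W k)"
      by (intro emeasure_mono_AE) (auto simp: G_def)
    also note bad
    also have "ennreal (min 1 w / 4) < ennreal w" using w by (intro ennreal_lessI) auto
    also have "ennreal w = emeasure lborel ?Q"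
      unfolding w_def using emeasure_lborel_ball_finite[of "0::real^2" 1] by (intro emeasure_eq_ennreal_measure[symmetric]) auto
    finally show False by simp
  qed
  moreover have "x \<notin> G" if lim: "((\<lambda>B. (1 / measure lebesgue B) * (LINT y:B|lebesgue. f y)) \<longlongrightarrow> f x)
      (shrinking_to (rect_basis \<Theta> \<sigma>) x)" for x
  proof
    assume x: "x \<in> G"
    \<comment> \<open>Convergence would keep the means over all small members containing
      \<open>x\<close> below \<open>f x + 1\<close>.\<close>
    have "eventually (\<lambda>B. (1 / measure lebesgue B) * (LINT y:B|lebesgue. f y) < f x + 1)
       (shrinking_to (rect_basis \<Theta> \<sigma>) x)"
      by (rule order_tendstoD(2)[OF lim]) simp
    then obtain d where d: "d > 0"
      "\<And>B. B \<in> rect_basis \<Theta> \<sigma> \<Longrightarrow> x \<in> B \<Longrightarrow> bounded B \<Longrightarrow> diameter B < d \<Longrightarrow>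
         (1 / measure lebesgue B) * (LINT y:B|lebesgue. f y) < f x + 1"
      unfolding eventually_shrinking_to by blast
    \<comment> \<open>A large \<open>k\<close> makes the rectangle from block \<open>k\<close> small
      enough for \<open>d\<close> and its mean, at least \<open>k + 1\<close>, too large.\<close>
    have "eventually (\<lambda>k. e k < d) sequentially"
      using summable_LIMSEQ_zero[OF sums_summable[OF esum]] d(1) by (rule order_tendstoD(2))
    moreover have "eventually (\<lambda>k. f x + 1 \<le> real k) sequentially"
      using filterlim_real_sequentially by (simp add: filterlim_at_top)
    ultimately have "eventually (\<lambda>k. e k < d \<and> f x + 1 \<le> real k) sequentially"
      by (rule eventually_conj)
    then obtain k where k: "e k < d" "f x + 1 \<le> real k"
      unfolding eventually_sequentially by blast
    obtain B where B: "B \<in> rect_basis \<Theta> \<sigma>" "x \<in> B" "bounded B" "diameter B < e k"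
      "0 < emeasure lborel B"
      "ennreal (real (Suc k)) * emeasure lborel B \<le> (\<integral>\<^sup>+y\<in>B. g k y \<partial>lborel)"
      using large[of k] x unfolding G_def by blast
    have Bs [measurable]: "B \<in> sets borel"
      using B(1) unfolding rect_basis_def by (auto simp: open_rect borel_open)
    have mB: "emeasure lborel B = ennreal (measure lborel B)"
      using emeasure_bounded_finite[OF B(3)] by (intro emeasure_eq_ennreal_measure) auto
    have mB0: "0 < measure lborel B" using B(5) unfolding mB by simp
    have "ennreal (real (Suc k) * measure lborel B) \<le> (\<integral>\<^sup>+y\<in>B. g k y \<partial>lborel)"
      using B(6) unfolding mB by (simp add: ennreal_mult')
    also have "\<dots> \<le> (\<integral>\<^sup>+y\<in>B. F y \<partial>lborel)"
      unfolding F_def by (intro nn_integral_mono mult_right_mono sum_le_suminf[of _ "{k}", simplified]) auto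
    also have "\<dots> = (\<integral>\<^sup>+y. ennreal (indicator B y *\<^sub>R f y) \<partial>lborel)"
      using fF by (intro nn_integral_cong_AE) (auto split: split_indicator)
    also have "\<dots> = ennreal (LINT y:B|lborel. f y)"
      unfolding set_lebesgue_integral_def
      by (intro nn_integral_eq_integral integrable_mult_indicator fint) (auto simp: f_def)
    finally have "real (Suc k) * measure lborel B \<le> (LINT y:B|lborel. f y)"
      by (subst (asm) ennreal_le_iff) (auto simp: set_lebesgue_integral_def f_def)
    moreover have "(LINT y:B|lebesgue. f y) = (LINT y:B|lborel. f y)"
      unfolding set_lebesgue_integral_def by (rule integral_completion) measurable
    moreover have "measure lebesgue B = measure lborel B" by (simp add: measure_completion)
    ultimately have "real (Suc k) \<le> (1 / measure lebesgue B) * (LINT y:B|lebesgue. f y)"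
      using mB0 by (simp add: field_simps)
    also have "\<dots> < f x + 1" using d(2)[OF B(1-3)] B(4) k(1) by linarith
    finally show False using k(2) by simp
  qed
  then have "AE x in lborel. x \<notin> G" by (rule eventually_mono[OF ae])
  ultimately show False by contradiction
qed

theorem proposition1:
  fixes \<Theta> :: "real set" and \<sigma> :: "real \<Rightarrow> real"
  assumes "\<Theta> \<subseteq> {0..<2 * pi}"
    and "\<forall>\<theta>\<in>\<Theta>. 1 \<le> \<sigma> \<theta>"
    and "(SUP \<theta>\<in>\<Theta>. ereal (\<sigma> \<theta>)) = \<infinity>"
  shows "differentiation_basis (rect_basis \<Theta> \<sigma>) \<and> homothecy_invariant (rect_basis \<Theta> \<sigma>) \<and>
         \<not> differentiates (rect_basis \<Theta> \<sigma>) L1"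
proof -
  have unb: "\<exists>\<theta>\<in>\<Theta>. C < \<sigma> \<theta>" for C
  proof -
    have "ereal C < (SUP \<theta>\<in>\<Theta>. ereal (\<sigma> \<theta>))" using assms(3) by simp
    then show ?thesis by (simp add: less_SUP_iff)
  qed
  then have "\<Theta> \<noteq> {}" by blast
  moreover have ge1: "1 \<le> \<sigma> \<theta>" if "\<theta> \<in> \<Theta>" for \<theta> using assms(2) that by blast
  ultimately have "differentiation_basis (rect_basis \<Theta> \<sigma>)" by (rule differentiation_basis_rect_basis)
  with not_differentiates_rect_basis[OF unb ge1] show ?thesis
    using homothecy_invariant_rect_basis by simp
qed

end
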